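(* Let $n\ge3$ and $D_n=\langle a,b\mid a^n=b^2=1,\ ab=ba^{-1}\rangle$. Then $\Gamma(D_n)$ is a split graph if and only if $n$ is an odd prime.
   Context: For a group $G$, $\Gamma(G)$ is the simple graph whose vertices are the subgroups of $G$ other than $\{1\}$ and $G$, two distinct vertices $H,K$ being adjacent iff $HK=KH$. A split graph is a graph whose vertex set can be partitioned into a clique and an independent set. *)

theory Defs
  imports
    "HOL-Algebra.Coset"
    "HOL-Algebra.Generated_Groups"
    "HOL-Computational_Algebra.Primes"
    "Graph_Theory.Pair_Digraph"
begin

section \<open>Groups given by generators and relations\<close>

datatype 'x letter = Gen 'x | Inv 'x

type_synonym 'x gword = "'x letter list"

text \<open>
  A set \<open>R\<close> of pairs of words lists the defining relations \<open>u = v\<close>. The group presented by the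
  generators of type \<open>'x\<close> and the relations \<open>R\<close> consists of all words modulo the least congruence
  of the free monoid that contains \<open>R\<close> and makes \<open>Inv x\<close> inverse to \<open>Gen x\<close>.
\<close>

inductive pres_eq :: "('x gword \<times> 'x gword) set \<Rightarrow> 'x gword \<Rightarrow> 'x gword \<Rightarrow> bool"
  for R where
  relation: "(u, v) \<in> R \<Longrightarrow> pres_eq R u v"
| gen_inv: "pres_eq R [Gen x, Inv x] []"
| inv_gen: "pres_eq R [Inv x, Gen x] []"
| refl: "pres_eq R u u"
| sym: "pres_eq R u v \<Longrightarrow> pres_eq R v u"
| trans: "pres_eq R u v \<Longrightarrow> pres_eq R v w \<Longrightarrow> pres_eq R u w"
| append: "pres_eq R u u' \<Longrightarrow> pres_eq R v v' \<Longrightarrow> pres_eq R (u @ v) (u' @ v')"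

definition pres_class :: "('x gword \<times> 'x gword) set \<Rightarrow> 'x gword \<Rightarrow> 'x gword set" where
  "pres_class R u = {v. pres_eq R u v}"

definition presented_group :: "('x gword \<times> 'x gword) set \<Rightarrow> 'x gword set monoid" where
  "presented_group R =
    \<lparr> carrier = range (pres_class R),
      monoid.mult = (\<lambda>U V. \<Union>u\<in>U. \<Union>v\<in>V. pres_class R (u @ v)),
      one = pres_class R [] \<rparr>"

lemma pres_class_eq_iff: "pres_class R u = pres_class R v \<longleftrightarrow> pres_eq R u v"
proof
  assume "pres_class R u = pres_class R v"
  moreover have "v \<in> pres_class R v"
    by (simp add: pres_class_def pres_eq.refl)
  ultimately show "pres_eq R u v"
    by (simp add: pres_class_def set_eq_iff)
next
  assume uv: "pres_eq R u v"
  show "pres_class R u = pres_class R v"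
    unfolding pres_class_def
    using pres_eq.trans[OF uv] pres_eq.trans[OF pres_eq.sym[OF uv]] by blast
qed

lemma mult_pres_class:
  "pres_class R u \<otimes>\<^bsub>presented_group R\<^esub> pres_class R v = pres_class R (u @ v)"
proof -
  have "pres_class R (u' @ v') = pres_class R (u @ v)"
    if "u' \<in> pres_class R u" "v' \<in> pres_class R v" for u' v'
  proof -
    from that have "pres_eq R u u'" "pres_eq R v v'"
      by (simp_all add: pres_class_def)
    then show ?thesis
      unfolding pres_class_eq_iff by (rule pres_eq.sym[OF pres_eq.append])
  qed
  moreover have "u \<in> pres_class R u" "v \<in> pres_class R v"
    by (auto simp: pres_class_def intro: pres_eq.refl)
  ultimately have "(\<Union>u'\<in>pres_class R u. \<Union>v'\<in>pres_class R v. pres_class R (u' @ v')) = pres_class R (u @ v)"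
    by blast
  then show ?thesis
    by (simp add: presented_group_def)
qed

lemma carrier_presented_group: "carrier (presented_group R) = range (pres_class R)"
  by (simp add: presented_group_def)

lemma one_presented_group: "\<one>\<^bsub>presented_group R\<^esub> = pres_class R []"
  by (simp add: presented_group_def)

lemma pres_class_relation: "(u, v) \<in> R \<Longrightarrow> pres_class R u = pres_class R v"
  by (simp add: pres_class_eq_iff pres_eq.relation)

primrec letter_inv :: "'x letter \<Rightarrow> 'x letter" where
  "letter_inv (Gen x) = Inv x"
| "letter_inv (Inv x) = Gen x"

lemma pres_eq_letter_inv: "pres_eq R [letter_inv l, l] []"
  by (cases l) (auto intro: pres_eq.gen_inv pres_eq.inv_gen)

lemma pres_eq_inv_word: "pres_eq R (rev (map letter_inv w) @ w) []"
proof (induction w)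
  case (Cons l w)
  have "pres_eq R (rev (map letter_inv w) @ [letter_inv l, l] @ w) (rev (map letter_inv w) @ [] @ w)"
    by (intro pres_eq.append pres_eq.refl pres_eq_letter_inv)
  then have "pres_eq R (rev (map letter_inv (l # w)) @ l # w) (rev (map letter_inv w) @ w)"
    by simp
  then show ?case
    using Cons by (rule pres_eq.trans)
qed (auto intro: pres_eq.refl)

lemma group_presented_group: "group (presented_group R)"
proof (rule groupI)
  fix U assume "U \<in> carrier (presented_group R)"
  then obtain w where w: "U = pres_class R w"
    by (auto simp: carrier_presented_group)
  have "pres_class R (rev (map letter_inv w)) \<otimes>\<^bsub>presented_group R\<^esub> U = \<one>\<^bsub>presented_group R\<^esub>"
    by (simp add: w mult_pres_class one_presented_group pres_class_eq_iff pres_eq_inv_word)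
  then show "\<exists>V\<in>carrier (presented_group R). V \<otimes>\<^bsub>presented_group R\<^esub> U = \<one>\<^bsub>presented_group R\<^esub>"
    by (auto simp: carrier_presented_group)
qed (auto simp: carrier_presented_group one_presented_group mult_pres_class)

primrec eval_letter :: "('h, 'm) monoid_scheme \<Rightarrow> ('x \<Rightarrow> 'h) \<Rightarrow> 'x letter \<Rightarrow> 'h" where
  "eval_letter H f (Gen x) = f x"
| "eval_letter H f (Inv x) = inv\<^bsub>H\<^esub> f x"

primrec eval_word :: "('h, 'm) monoid_scheme \<Rightarrow> ('x \<Rightarrow> 'h) \<Rightarrow> 'x gword \<Rightarrow> 'h" where
  "eval_word H f [] = \<one>\<^bsub>H\<^esub>"
| "eval_word H f (l # w) = eval_letter H f l \<otimes>\<^bsub>H\<^esub> eval_word H f w"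

lemma presented_group_universal:
  fixes f :: "'x \<Rightarrow> 'h" and H :: "('h, 'm) monoid_scheme"
  assumes "group H" and f: "\<And>x. f x \<in> carrier H"
    and R: "\<And>u v. (u, v) \<in> R \<Longrightarrow> eval_word H f u = eval_word H f v"
  shows "\<exists>h\<in>hom (presented_group R) H. \<forall>x. h (pres_class R [Gen x]) = f x"
proof -
  interpret H: group H by fact
  have letter: "eval_letter H f l \<in> carrier H" for l
    using f by (cases l) auto
  have closed: "eval_word H f w \<in> carrier H" for w
    using letter by (induction w) auto
  have app: "eval_word H f (u @ v) = eval_word H f u \<otimes>\<^bsub>H\<^esub> eval_word H f v" for u v
    using letter closed by (induction u) (auto simp: H.m_assoc)
  have eq: "eval_word H f u = eval_word H f v" if "pres_eq R u v" for u v
    using that by induction (auto simp: R app f)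
  define h where "h U = eval_word H f (SOME u. U = pres_class R u)" for U
  have h: "h (pres_class R w) = eval_word H f w" for w
    unfolding h_def by (rule someI2[of _ w]) (auto simp: pres_class_eq_iff dest: eq)
  have "h \<in> hom (presented_group R) H"
    by (auto simp: hom_def carrier_presented_group mult_pres_class h app closed)
  moreover have "\<forall>x. h (pres_class R [Gen x]) = f x"
    using f by (simp add: h)
  ultimately show ?thesis by blast
qed

lemma presented_group_generated:
  "generate (presented_group R) (range (\<lambda>x. pres_class R [Gen x])) = carrier (presented_group R)"
proof -
  interpret group "presented_group R" by (rule group_presented_group)
  let ?S = "range (\<lambda>x. pres_class R [Gen x])"
  have S: "?S \<subseteq> carrier (presented_group R)"
    by (auto simp: carrier_presented_group)
  have letter: "pres_class R [l] \<in> generate (presented_group R) ?S" for l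
  proof (cases l)
    case (Inv x)
    have "inv\<^bsub>presented_group R\<^esub> pres_class R [Gen x] = pres_class R [Inv x]"
      by (rule inv_equality)
        (auto simp: carrier_presented_group mult_pres_class one_presented_group
           pres_class_eq_iff intro: pres_eq.inv_gen)
    then show ?thesis
      using generate.inv[of "pres_class R [Gen x]" ?S "presented_group R"] Inv by auto
  qed (auto intro: generate.incl)
  have "pres_class R w \<in> generate (presented_group R) ?S" for w
  proof (induction w)
    case Nil
    show ?case using generate.one[of "presented_group R"] by (simp add: one_presented_group)
  next
    case (Cons l w)
    then show ?case
      using generate.eng[OF letter[of l] Cons] by (simp add: mult_pres_class)
  qed
  then show ?thesis
    using generate_incl[OF S] by (auto simp: carrier_presented_group)
qed

section \<open>Dihedral groups\<close>

datatype dihedral_gen = gen_a | gen_b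

definition dihedral_relations :: "nat \<Rightarrow> (dihedral_gen gword \<times> dihedral_gen gword) set" where
  "dihedral_relations n =
    {(replicate n (Gen gen_a), []),
     (replicate 2 (Gen gen_b), []),
     ([Gen gen_a, Gen gen_b], [Gen gen_b, Inv gen_a])}"

definition dihedral_group :: "nat \<Rightarrow> dihedral_gen gword set monoid" where
  "dihedral_group n = presented_group (dihedral_relations n)"

section \<open>The permutability graph of subgroups and split graphs\<close>

text \<open>
  Simple graphs, finite or infinite, are represented by symmetric loop-free digraphs without
  parallel arcs.
\<close>

definition permutability_graph :: "('g, 'm) monoid_scheme \<Rightarrow> 'g set pair_pre_digraph" where
  "permutability_graph G =
    (let V = {H. subgroup H G \<and> H \<noteq> {\<one>\<^bsub>G\<^esub>} \<and> H \<noteq> carrier G}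
     in \<lparr> pverts = V,
          parcs = {(H, K). H \<in> V \<and> K \<in> V \<and> H \<noteq> K \<and> H <#>\<^bsub>G\<^esub> K = K <#>\<^bsub>G\<^esub> H} \<rparr>)"

lemma pair_bidirected_digraph_permutability_graph:
  "pair_bidirected_digraph (permutability_graph G)"
  by unfold_locales
    (auto simp: permutability_graph_def Let_def symmetric_def intro!: symI)

definition clique :: "'v pair_pre_digraph \<Rightarrow> 'v set \<Rightarrow> bool" where
  "clique \<Gamma> C \<longleftrightarrow> C \<subseteq> pverts \<Gamma> \<and> (\<forall>u\<in>C. \<forall>v\<in>C. u \<noteq> v \<longrightarrow> (u, v) \<in> parcs \<Gamma>)"

definition independent_set :: "'v pair_pre_digraph \<Rightarrow> 'v set \<Rightarrow> bool" where
  "independent_set \<Gamma> I \<longleftrightarrow> I \<subseteq> pverts \<Gamma> \<and> (\<forall>u\<in>I. \<forall>v\<in>I. (u, v) \<notin> parcs \<Gamma>)"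

text \<open>Following the usual convention, one of the two parts may be empty.\<close>

definition split_graph :: "'v pair_pre_digraph \<Rightarrow> bool" where
  "split_graph \<Gamma> \<longleftrightarrow> pair_bidirected_digraph \<Gamma> \<and>
    (\<exists>C I. pverts \<Gamma> = C \<union> I \<and> C \<inter> I = {} \<and> clique \<Gamma> C \<and> independent_set \<Gamma> I)"

end

theory Submission
  imports Defs
begin

text \<open>
  If \<open>n\<close> is an odd prime, the only proper nontrivial subgroups are the rotation subgroup and the
  \<open>n\<close> subgroups of order 2 generated by reflections; no two of the latter permute, so
  \<open>\<Gamma>(D\<^sub>n)\<close> is a star. For \<open>d\<close> dividing \<open>n\<close>, let \<open>D d i\<close> be the subgroup generated by \<open>a\<^sup>d\<close> and
  \<open>a\<^sup>ib\<close>. Then \<open>D d i\<close> and \<open>D d' j\<close> permute iff \<open>gcd d d'\<close> divides \<open>2(i - j)\<close>. Hence, if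
  \<open>n = 2m\<close>, the edges \<open>D n 0 - D n m\<close> and \<open>D n 1 - D n (m+1)\<close> form an induced \<open>2K\<^sub>2\<close>, and if \<open>n\<close> is
  odd with a proper divisor \<open>d \<ge> 3\<close>, so do \<open>D n 0 - D d 0\<close> and \<open>D n 1 - D d 1\<close>. A split graph
  contains no induced \<open>2K\<^sub>2\<close>.
\<close>

section \<open>Split graphs and permuting subgroups\<close>

lemma pverts_permutability_graph:
  "H \<in> pverts (permutability_graph G) \<longleftrightarrow> subgroup H G \<and> H \<noteq> {\<one>\<^bsub>G\<^esub>} \<and> H \<noteq> carrier G"
  by (simp add: permutability_graph_def Let_def)

lemma parcs_permutability_graph:
  "(H, K) \<in> parcs (permutability_graph G) \<longleftrightarrow>
     H \<in> pverts (permutability_graph G) \<and> K \<in> pverts (permutability_graph G) \<and> H \<noteq> K \<and>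
     H <#>\<^bsub>G\<^esub> K = K <#>\<^bsub>G\<^esub> H"
  by (simp add: permutability_graph_def Let_def)

text \<open>Each edge has an endpoint in the clique part, since its ends cannot both lie in the
  independent part. The two endpoints so obtained are distinct, hence adjacent, and they form one of
  the excluded cross pairs.\<close>

lemma split_graph_no_2K2:
  assumes "split_graph \<Gamma>" and edges: "(u, v) \<in> parcs \<Gamma>" "(x, y) \<in> parcs \<Gamma>"
    and ne: "{u, v} \<inter> {x, y} = {}"
    and no: "(u, x) \<notin> parcs \<Gamma>" "(u, y) \<notin> parcs \<Gamma>" "(v, x) \<notin> parcs \<Gamma>" "(v, y) \<notin> parcs \<Gamma>"
  shows False
proof -
  from assms(1) obtain C I where CI: "pverts \<Gamma> = C \<union> I" "clique \<Gamma> C" "independent_set \<Gamma> I"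
    and "pair_bidirected_digraph \<Gamma>"
    by (auto simp: split_graph_def)
  then interpret pair_bidirected_digraph \<Gamma> by simp
  have "{u, v, x, y} \<subseteq> C \<union> I"
    using edges CI(1) by (metis empty_subsetI in_arcsD1 in_arcsD2 insert_subset)
  moreover have "\<not> (u \<in> I \<and> v \<in> I)" "\<not> (x \<in> I \<and> y \<in> I)"
    using edges CI(3) by (auto simp: independent_set_def)
  ultimately obtain p q where "p \<in> {u, v}" "q \<in> {x, y}" "p \<in> C" "q \<in> C"
    by auto
  then show False
    using no ne CI(2) by (auto simp: clique_def)
qed

section \<open>Arithmetic in dihedral groups\<close>

text \<open>
  The element \<open>e k s\<close> stands for \<open>a\<^sup>k\<close> if \<open>s\<close> is false (a rotation) and for \<open>a\<^sup>kb\<close> if \<open>s\<close> is true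
  (a reflection).
\<close>

locale dihedral = group G for G (structure) +
  fixes n :: int and e :: "int \<Rightarrow> bool \<Rightarrow> 'a"
  assumes carrier_eq: "carrier G = {e k s | k s. True}"
    and e_mult: "e k s \<otimes> e l t = e (if s then k - l else k + l) (s \<noteq> t)"
    and e_eq_iff: "e k s = e l t \<longleftrightarrow> s = t \<and> n dvd k - l"
    and n_ge_3: "n \<ge> 3"
begin

lemma e_closed [simp]: "e k s \<in> carrier G"
  using carrier_eq by blast

lemma e_set_eqI:
  assumes "K \<subseteq> carrier G" "L \<subseteq> carrier G" "\<And>k s. e k s \<in> K \<longleftrightarrow> e k s \<in> L"
  shows "K = L"
  using assms unfolding carrier_eq by blast

lemma one_eq: "\<one> = e 0 False"
  using r_cancel_one[of "e 0 False" "e 0 False"] by (simp add: e_mult)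

lemma inv_e: "inv (e k s) = e (if s then k else - k) s"
  by (rule inv_equality) (auto simp: e_mult one_eq)

section \<open>The subgroups containing a reflection, and when they permute\<close>

definition D :: "int \<Rightarrow> int \<Rightarrow> 'a set" where
  "D d i = {e k s | k s. d dvd k - (if s then i else 0)}"

text \<open>An element fixes its exponent only modulo \<open>n\<close>; as \<open>d\<close> divides
  \<open>n\<close>, divisibility by \<open>d\<close> does not depend on the representative.\<close>

lemma mem_D: "d dvd n \<Longrightarrow> e k s \<in> D d i \<longleftrightarrow> d dvd k - (if s then i else 0)"
proof
  assume d: "d dvd n" and "e k s \<in> D d i"
  then obtain l where l: "n dvd k - l" "d dvd l - (if s then i else 0)"
    by (auto simp: D_def e_eq_iff)
  then have "d dvd (k - l) + (l - (if s then i else 0))"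
    by (intro dvd_add[OF dvd_trans[OF d]])
  then show "d dvd k - (if s then i else 0)" by simp
next
  assume "d dvd k - (if s then i else 0)"
  then show "e k s \<in> D d i"
    unfolding D_def by blast
qed

lemma D_subgroup: "d dvd n \<Longrightarrow> subgroup (D d i) G"
proof
  assume d: "d dvd n"
  show "D d i \<subseteq> carrier G"
    by (auto simp: D_def)
  show "\<one> \<in> D d i"
    using d by (simp add: one_eq mem_D)
  fix x assume x: "x \<in> D d i"
  then obtain k s where xk: "x = e k s" "d dvd k - (if s then i else 0)"
    by (auto simp: D_def)
  then show "inv x \<in> D d i"
    using d by (auto simp: inv_e mem_D)
  fix y assume "y \<in> D d i"
  then obtain l t where yl: "y = e l t" "d dvd l - (if t then i else 0)"
    by (auto simp: D_def)
  \<comment> \<open>After the shifts by \<open>i\<close>, the exponent of the product is the sum if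
    \<open>x\<close> is a rotation and the difference if it is a reflection.\<close>
  have "d dvd (k - (if s then i else 0)) + (l - (if t then i else 0))"
    "d dvd (k - (if s then i else 0)) - (l - (if t then i else 0))"
    using xk yl by (auto intro: dvd_add dvd_diff)
  then show "x \<otimes> y \<in> D d i"
    using d unfolding xk yl by (cases s; cases t) (auto simp: e_mult mem_D algebra_simps)
qed

lemma D_vertex:
  assumes "d dvd n" "d \<ge> 2"
  shows "D d i \<in> pverts (permutability_graph G)"
proof -
  have "e i True \<in> D d i" "e 1 False \<notin> D d i" "e i True \<noteq> \<one>"
    using assms by (auto simp: mem_D one_eq e_eq_iff zdvd_not_zless)
  then show ?thesis
    using D_subgroup[OF assms(1)] e_closed
    unfolding pverts_permutability_graph by (metis singletonD)
qed

text \<open>A product with at most one reflection can be reversed at the cost of inverting a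
  rotation. Two reflections multiply to the rotation by \<open>k - l\<close>; reversing them asks
  for \<open>k'\<close> congruent to \<open>i\<close> modulo \<open>d\<close> and \<open>l'\<close>
  congruent to \<open>j\<close> modulo \<open>d'\<close> with \<open>l' - k' = k - l\<close>, and
  the only obstruction is \<open>2 * (i - j)\<close> modulo \<open>gcd d d'\<close>.\<close>

lemma D_mult_subset:
  assumes "d dvd n" "d' dvd n" "gcd d d' dvd 2 * (i - j)"
  shows "D d i <#> D d' j \<subseteq> D d' j <#> D d i"
proof
  fix z assume "z \<in> D d i <#> D d' j"
  then obtain k s l t where z: "z = e k s \<otimes> e l t"
    and k: "d dvd k - (if s then i else 0)" and l: "d' dvd l - (if t then j else 0)"
    by (auto simp: set_mult_def D_def)
  have "\<exists>k' s' l' t'. e k s \<otimes> e l t = e l' t' \<otimes> e k' s' \<and> d dvd k' - (if s' then i else 0) \<and>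
      d' dvd l' - (if t' then j else 0)"
  proof (cases "s \<and> t")
    case False
    then show ?thesis
    proof (intro exI conjI)
      show "e k s \<otimes> e l t = e (if s then - l else l) t \<otimes> e (if t then - k else k) s"
        using False by (cases s; cases t) (simp_all add: e_mult add.commute)
      show "d dvd (if t then - k else k) - (if s then i else 0)"
        using False k by auto
      show "d' dvd (if s then - l else l) - (if t then j else 0)"
        using False l by auto
    qed
  next
    case True
    obtain u v where uv: "u * d + v * d' = gcd d d'"
      using bezout_int by blast
    obtain q where q: "2 * (i - j) = gcd d d' * q"
      using assms(3) by blast
    obtain x y where xy: "k = i + d * x" "l = j + d' * y"
      using k l True by (auto simp: dvd_def algebra_simps)
    \<comment> \<open>By Bezout, \<open>u * q\<close> and \<open>v * q\<close> write
      \<open>2 * (i - j)\<close> as a combination of \<open>d\<close> and \<open>d'\<close>;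
      \<open>x\<close> and \<open>y\<close> carry over the offsets of \<open>k\<close> and
      \<open>l\<close>.\<close>
    let ?k' = "i - d * (x + u * q)" and ?l' = "j + d' * (v * q - y)"
    have "2 * (i - j) = d * (u * q) + d' * (v * q)"
      unfolding q uv[symmetric] by (simp add: algebra_simps)
    then have "k - l = ?l' - ?k'"
      by (simp add: xy algebra_simps)
    then have "e k s \<otimes> e l t = e ?l' True \<otimes> e ?k' True"
      using True by (simp add: e_mult)
    then show ?thesis
      by (intro exI[of _ ?k'] exI[of _ ?l'] exI[of _ True]) auto
  qed
  then show "z \<in> D d' j <#> D d i"
    unfolding z set_mult_def D_def by blast
qed

text \<open>Necessity follows from reversing the single product of \<open>e i True\<close> and
  \<open>e j True\<close>, the rotation by \<open>i - j\<close>. If the new factors are reflections,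
  then modulo the gcd \<open>i - j\<close> equals \<open>j - i\<close>; if they are rotations,
  \<open>i - j\<close> itself vanishes there.\<close>

lemma D_permute_iff:
  assumes "d dvd n" "d' dvd n"
  shows "D d i <#> D d' j = D d' j <#> D d i \<longleftrightarrow> gcd d d' dvd 2 * (i - j)"
proof
  assume eq: "D d i <#> D d' j = D d' j <#> D d i"
  have "e i True \<otimes> e j True \<in> D d i <#> D d' j"
    using assms mem_D[of d i True i] mem_D[of d' j True j] unfolding set_mult_def by auto
  then obtain l t k s where st: "e i True \<otimes> e j True = e l t \<otimes> e k s"
    and k: "d dvd k - (if s then i else 0)" and l: "d' dvd l - (if t then j else 0)"
    unfolding eq by (auto simp: set_mult_def D_def)
  from st have s: "s = t" and "n dvd (i - j) - (if t then l - k else l + k)"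
    by (auto simp: e_mult e_eq_iff)
  then have g: "gcd d d' dvd (i - j) - (if t then l - k else l + k)"
    using assms(1) by (meson dvd_trans gcd_dvd1)
  have k': "gcd d d' dvd k - (if s then i else 0)" and l': "gcd d d' dvd l - (if t then j else 0)"
    using k l by (meson dvd_trans gcd_dvd1 gcd_dvd2)+
  show "gcd d d' dvd 2 * (i - j)"
  proof (cases t)
    case True
    then have "gcd d d' dvd ((i - j) - (l - k)) + ((l - j) - (k - i))"
      using g k' l' s by (metis dvd_add dvd_diff)
    then show ?thesis by (simp add: algebra_simps)
  next
    case False
    then have "gcd d d' dvd ((i - j) - (l + k)) + (l + k)"
      using g k' l' s by (metis diff_zero dvd_add)
    then show ?thesis by (metis diff_add_cancel dvd_mult)
  qed
next
  assume g: "gcd d d' dvd 2 * (i - j)"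
  moreover have "2 * (j - i) = - (2 * (i - j))" by simp
  ultimately have "gcd d' d dvd 2 * (j - i)"
    by (simp only: gcd.commute[of d' d] dvd_minus_iff)
  with g show "D d i <#> D d' j = D d' j <#> D d i"
    using assms by (intro equalityI D_mult_subset)
qed

section \<open>Induced pairs of disjoint edges\<close>

text \<open>Turns an induced 2K2 into divisibility conditions. One end of each edge has order two;
  allowing \<open>d = n\<close> lets the same statement serve the even and the composite
  case.\<close>

lemma not_split_of_2K2:
  assumes "d dvd n" "d \<ge> 2" "D n i \<noteq> D d j" "D n k \<noteq> D d l"
    and edges: "d dvd 2 * (i - j)" "d dvd 2 * (k - l)"
    and no: "\<not> n dvd 2 * (i - k)" "\<not> d dvd 2 * (i - l)" "\<not> d dvd 2 * (j - k)" "\<not> d dvd 2 * (j - l)"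
  shows "\<not> split_graph (permutability_graph G)"
proof
  assume split: "split_graph (permutability_graph G)"
  have V: "D n x \<in> pverts (permutability_graph G)" "D d x \<in> pverts (permutability_graph G)" for x
    using assms n_ge_3 by (auto intro!: D_vertex)
  have g: "gcd n d = d" "gcd d n = d" "gcd n n = n" "gcd d d = d"
    using assms(1,2) n_ge_3 by (auto simp: gcd_proj1_iff gcd_proj2_iff)
  have P: "D n x <#> D d y = D d y <#> D n x \<longleftrightarrow> d dvd 2 * (x - y)"
    "D d x <#> D n y = D n y <#> D d x \<longleftrightarrow> d dvd 2 * (x - y)"
    "D n x <#> D n y = D n y <#> D n x \<longleftrightarrow> n dvd 2 * (x - y)"
    "D d x <#> D d y = D d y <#> D d x \<longleftrightarrow> d dvd 2 * (x - y)" for x y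
    using D_permute_iff[of n d] D_permute_iff[of d n] D_permute_iff[of n n] D_permute_iff[of d d]
      g assms(1) by auto
  have E: "(D n i, D d j) \<in> parcs (permutability_graph G)"
    "(D n k, D d l) \<in> parcs (permutability_graph G)"
    using assms(3,4) edges V by (simp_all only: parcs_permutability_graph P simp_thms)
  have N: "(D n i, D n k) \<notin> parcs (permutability_graph G)" "(D n i, D d l) \<notin> parcs (permutability_graph G)"
    "(D d j, D n k) \<notin> parcs (permutability_graph G)" "(D d j, D d l) \<notin> parcs (permutability_graph G)"
    using no by (simp_all only: parcs_permutability_graph P simp_thms not_False_eq_True)
  \<comment> \<open>Equal subgroups permute, so subgroups that do not permute are distinct.\<close>
  have "D n i \<noteq> D n k" "D n i \<noteq> D d l" "D d j \<noteq> D n k" "D d j \<noteq> D d l"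
    using P(3)[of i k] P(1)[of i l] P(2)[of j k] P(4)[of j l] no by auto
  then have "{D n i, D d j} \<inter> {D n k, D d l} = {}"
    by simp
  from split_graph_no_2K2[OF split E this N] show False .
qed

lemma not_split_even:
  assumes "even n"
  shows "\<not> split_graph (permutability_graph G)"
proof -
  obtain m where m: "n = 2 * m" "m \<ge> 2"
    using assms n_ge_3 by auto
  have "e i True \<notin> D n (i + m)" "e i True \<in> D n i" for i
    using m by (auto simp: mem_D zdvd_not_zless)
  then have ne: "D n 0 \<noteq> D n m" "D n 1 \<noteq> D n (m + 1)"
    by (metis add_0, metis add.commute)
  \<comment> \<open>Now \<open>n\<close> divides twice a number iff \<open>m\<close> divides that
    number, so the cross conditions only need that \<open>m\<close> does not divide 1,
    \<open>m - 1\<close> or \<open>m + 1\<close>.\<close>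
  have "\<not> m dvd 1 + m" "\<not> m dvd m - 1" "\<not> m dvd 1"
    using m by (auto simp: zdvd_not_zless dvd_diff_right_iff)
  then have no: "\<not> n dvd 2 * (0 - 1)" "\<not> n dvd 2 * (0 - (m + 1))" "\<not> n dvd 2 * (m - 1)"
    "\<not> n dvd 2 * (m - (m + 1))"
    unfolding m(1) dvd_mult_cancel_left by (auto simp: dvd_diff_commute add.commute)
  have "n dvd 2 * (0 - m)" "n dvd 2 * (1 - (m + 1))"
    unfolding m(1) by simp_all
  from not_split_of_2K2[OF dvd_refl _ ne this no] show ?thesis
    using n_ge_3 by simp
qed

text \<open>\<open>D n i\<close> lies inside \<open>D d i\<close>, so the two permute. Every cross
  condition would make \<open>n\<close> or \<open>d\<close> a divisor of 2, which
  \<open>3 \<le> d\<close> rules out.\<close>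

lemma not_split_divisor:
  assumes "d dvd n" "3 \<le> d" "d < n"
  shows "\<not> split_graph (permutability_graph G)"
proof -
  have "e (i + d) True \<in> D d i" "e (i + d) True \<notin> D n i" for i
    using assms by (auto simp: mem_D zdvd_not_zless)
  then have ne: "D n i \<noteq> D d i" for i
    by blast
  have no: "\<not> n dvd 2 * (0 - 1)" "\<not> d dvd 2 * (0 - 1)"
    using assms by (simp_all add: zdvd_not_zless)
  have "d dvd 2 * (i - i)" for i
    by simp
  from not_split_of_2K2[OF assms(1) _ ne ne this this no(1) no(2) no(2) no(2)] show ?thesis
    using assms(2) by simp
qed

section \<open>The rotation subgroup and the case of prime \<open>n\<close>\<close>

definition Rot :: "'a set" where
  "Rot = {e k False | k. True}"

lemma mem_Rot: "e k s \<in> Rot \<longleftrightarrow> \<not> s"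
  by (cases s) (auto simp: Rot_def e_eq_iff intro: exI[of _ k])

lemma Rot_subset: "Rot \<subseteq> carrier G"
  by (auto simp: Rot_def)

lemma Rot_vertex: "Rot \<in> pverts (permutability_graph G)"
proof -
  have "subgroup Rot G"
    by unfold_locales (auto simp: Rot_def e_mult inv_e one_eq)
  moreover have "e 1 False \<in> Rot" "e 1 False \<noteq> \<one>" "e 0 True \<notin> Rot"
    using n_ge_3 by (auto simp: mem_Rot one_eq e_eq_iff zdvd_not_zless)
  ultimately show ?thesis
    using e_closed unfolding pverts_permutability_graph by (metis singletonD)
qed

text \<open>Nonnegative multiples are enough, since a multiplier can be reduced modulo
  \<open>n\<close>.\<close>

lemma e_pow_mem:
  assumes "subgroup K G" "e k False \<in> K"
  shows "e (int q * k) False \<in> K"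
proof (induction q)
  case 0
  then show ?case using subgroup.one_closed[OF assms(1)] by (simp add: one_eq)
next
  case (Suc q)
  then have "e k False \<otimes> e (int q * k) False \<in> K"
    using assms by (simp add: subgroup.m_closed)
  then show ?case by (simp add: e_mult algebra_simps)
qed

text \<open>For prime \<open>n\<close>, one nontrivial rotation generates all of them, and a
  reflection in addition would give the whole group, so \<open>K\<close> is \<open>Rot\<close>.
  Without nontrivial rotations, two reflections in \<open>K\<close> must coincide because their
  product is a rotation, so \<open>K\<close> has order two.\<close>

lemma vertex_cases:
  assumes "prime n" and K: "K \<in> pverts (permutability_graph G)"
  shows "K = Rot \<or> (\<exists>i. K = D n i)"
proof (cases "\<exists>k. e k False \<in> K \<and> \<not> n dvd k")
  case True
  have sub: "subgroup K G" and ne: "K \<noteq> carrier G"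
    using K by (auto simp: pverts_permutability_graph)
  from True obtain k where k: "e k False \<in> K" "\<not> n dvd k" by blast
  then have "coprime n k"
    using \<open>prime n\<close> prime_imp_coprime by blast
  then obtain u v where uv: "u * n + v * k = 1"
    using bezout_int[of n k] by auto
  have rot: "e l False \<in> K" for l
  proof -
    \<comment> \<open>\<open>v\<close> inverts \<open>k\<close> modulo \<open>n\<close>, so
      \<open>v * l * k\<close> is congruent to \<open>l\<close>; reducing \<open>v * l\<close>
      modulo \<open>n\<close> makes the multiplier a natural number.\<close>
    let ?q = "nat ((v * l) mod n)"
    have "(int ?q * k) mod n = (v * l * k) mod n"
      using n_ge_3 by (simp add: mod_mult_left_eq)
    then have "n dvd int ?q * k - v * l * k"
      by (simp add: mod_eq_dvd_iff)
    moreover have "v * l * k - l = n * (- u * l)"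
      using arg_cong[OF uv, of "\<lambda>x. l * x"] by (simp add: algebra_simps)
    ultimately have "n dvd (int ?q * k - v * l * k) + (v * l * k - l)"
      by (metis dvd_add dvd_triv_left)
    then have "e (int ?q * k) False = e l False"
      by (simp add: e_eq_iff)
    then show ?thesis
      using e_pow_mem[OF sub k(1), of ?q] by simp
  qed
  have "e l True \<notin> K" for l
  proof
    assume l: "e l True \<in> K"
    have "e j s \<in> K" for j s
    proof (cases s)
      case True
      have "e (j - l) False \<otimes> e l True \<in> K"
        using sub rot l by (simp add: subgroup.m_closed)
      then show ?thesis using True by (simp add: e_mult)
    qed (use rot in auto)
    then have "carrier G \<subseteq> K" by (auto simp: carrier_eq)
    then show False using ne subgroup.subset[OF sub] by blast
  qed
  with rot have "e l s \<in> K \<longleftrightarrow> e l s \<in> Rot" for l s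
    by (cases s) (simp_all add: mem_Rot)
  then have "K = Rot"
    using subgroup.subset[OF sub] Rot_subset by (intro e_set_eqI)
  then show ?thesis by simp
next
  case False
  have sub: "subgroup K G" and ne: "K \<noteq> {\<one>}"
    using K by (auto simp: pverts_permutability_graph)
  have "\<one> \<in> K" using sub by (rule subgroup.one_closed)
  then obtain x where x: "x \<in> K" "x \<noteq> \<one>" "x \<in> carrier G"
    using ne subgroup.subset[OF sub] by blast
  then obtain i s where i: "x = e i s" by (auto simp: carrier_eq)
  then have s: "s"
    using False x by (cases s) (auto simp: one_eq e_eq_iff)
  have "e k t \<in> K \<longleftrightarrow> n dvd k - (if t then i else 0)" for k t
  proof
    assume kt: "e k t \<in> K"
    show "n dvd k - (if t then i else 0)"
    proof (cases t)
      case True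
      have "e k t \<otimes> e i True \<in> K"
        using sub kt x i s by (simp add: subgroup.m_closed)
      then show ?thesis
        using True False by (auto simp: e_mult)
    qed (use False kt in auto)
  next
    assume "n dvd k - (if t then i else 0)"
    then have "e k t = (if t then x else \<one>)"
      using i s by (auto simp: e_eq_iff one_eq)
    then show "e k t \<in> K"
      using x \<open>\<one> \<in> K\<close> by auto
  qed
  then have "K = D n i"
    using subgroup.subset[OF sub] subgroup.subset[OF D_subgroup[of n i]]
    by (intro e_set_eqI) (auto simp: mem_D)
  then show ?thesis by blast
qed

text \<open>The clique is the single vertex \<open>Rot\<close>. Two subgroups \<open>D n i\<close>
  and \<open>D n j\<close> permute only if \<open>n\<close> divides \<open>2 * (i - j)\<close>, and
  for odd \<open>n\<close> the factor 2 cancels, so they are equal.\<close>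

lemma split_prime:
  assumes "prime n" "odd n"
  shows "split_graph (permutability_graph G)"
proof -
  let ?V = "pverts (permutability_graph G)"
  have eq: "D n i = D n j" if "D n i <#> D n j = D n j <#> D n i" for i j
  proof -
    have "gcd n n dvd 2 * (i - j)"
      using that by (rule D_permute_iff[OF dvd_refl dvd_refl, THEN iffD1])
    then have "n dvd 2 * (i - j)"
      by (rule dvd_trans[rotated]) simp
    moreover have "coprime n 2"
      using assms by simp
    ultimately have ij: "n dvd i - j"
      by (simp only: coprime_dvd_mult_right_iff)
    have "n dvd k - i \<longleftrightarrow> n dvd k - j" for k
      using dvd_add[OF _ ij, of "k - i"] dvd_diff[OF _ ij, of "k - j"] by auto
    then show ?thesis
      unfolding D_def by auto
  qed
  have "(H, K) \<notin> parcs (permutability_graph G)" if "H \<in> ?V - {Rot}" "K \<in> ?V - {Rot}" for H K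
  proof -
    from that obtain i j where "H = D n i" "K = D n j"
      using vertex_cases[OF assms(1)] by blast
    then show ?thesis
      using eq[of i j] by (auto simp only: parcs_permutability_graph)
  qed
  then have "independent_set (permutability_graph G) (?V - {Rot})"
    by (auto simp: independent_set_def)
  moreover have "clique (permutability_graph G) {Rot}"
    using Rot_vertex by (auto simp: clique_def)
  ultimately show ?thesis
    using Rot_vertex pair_bidirected_digraph_permutability_graph
    unfolding split_graph_def by (intro conjI exI[of _ "{Rot}"] exI[of _ "?V - {Rot}"]) auto
qed

theorem split_graph_iff: "split_graph (permutability_graph G) \<longleftrightarrow> prime n \<and> odd n"
proof
  assume split: "split_graph (permutability_graph G)"
  have odd: "odd n"
    using split not_split_even by blast
  moreover have "prime n"
  proof (rule ccontr)
    assume "\<not> prime n"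
    then obtain d where d: "d \<ge> 0" "d dvd n" "d \<noteq> 1" "d \<noteq> n"
      using n_ge_3 by (auto simp: prime_int_iff)
    then have "d \<noteq> 0" "d \<le> n"
      using n_ge_3 zdvd_imp_le[of d n] by auto
    with d have d: "d dvd n" "1 < d" "d < n"
      by auto
    \<comment> \<open>Oddness lifts the bound on the divisor from 2 to 3.\<close>
    then have "d \<noteq> 2" using odd by auto
    then show False
      using d split not_split_divisor[of d] by simp
  qed
  ultimately show "prime n \<and> odd n" by simp
qed (simp add: split_prime)

end

section \<open>Normal forms in the presented dihedral group\<close>

primrec reflects :: "dihedral_gen gword \<Rightarrow> bool" where
  "reflects [] = False"
| "reflects (l # w) = (if l \<in> {Gen gen_b, Inv gen_b} then \<not> reflects w else reflects w)"

text \<open>A leading \<open>b\<close> is moved to the right end of the word, which inverts the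
  rotation it passes. \<open>Inv gen_b\<close> is treated like \<open>Gen gen_b\<close> because
  \<open>b\<close> is an involution.\<close>

primrec exponent :: "dihedral_gen gword \<Rightarrow> int" where
  "exponent [] = 0"
| "exponent (l # w) = (if l = Gen gen_a then exponent w + 1
     else if l = Inv gen_a then exponent w - 1 else - exponent w)"

lemma reflects_append: "reflects (u @ v) = (reflects u \<noteq> reflects v)"
  by (induction u) auto

lemma exponent_append:
  "exponent (u @ v) = (if reflects u then exponent u - exponent v else exponent u + exponent v)"
proof (induction u)
  case (Cons l u)
  show ?case
  proof (cases l)
    case (Gen x)
    then show ?thesis using Cons by (cases x) auto
  next
    case (Inv x)
    then show ?thesis using Cons by (cases x) auto
  qed
qed simp

lemma exponent_replicate:
  "exponent (replicate m (Gen gen_a)) = int m" "exponent (replicate m (Inv gen_a)) = - int m"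
  by (induction m) auto

lemma reflects_replicate:
  "\<not> reflects (replicate m (Gen gen_a))" "\<not> reflects (replicate m (Inv gen_a))"
  by (induction m) auto

text \<open>Shows that the presentation does not collapse: distinct normal forms modulo
  \<open>n\<close> stay distinct.\<close>

lemma pres_eq_dihedral_invariant:
  assumes "pres_eq (dihedral_relations n) u v"
  shows "reflects u = reflects v \<and> int n dvd exponent u - exponent v"
  using assms
proof (induction rule: pres_eq.induct)
  case (relation u v)
  then show ?case
    by (auto simp: dihedral_relations_def exponent_replicate reflects_replicate numeral_2_eq_2)
next
  case (gen_inv x)
  then show ?case by (cases x) auto
next
  case (inv_gen x)
  then show ?case by (cases x) auto
next
  case (sym u v)
  then show ?case by (metis dvd_diff_commute)
next
  case (trans u v w)
  then have "int n dvd (exponent u - exponent v) + (exponent v - exponent w)"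
    using dvd_add by blast
  with trans show ?case by simp
next
  case (append u u' v v')
  \<comment> \<open>The sign with which the exponent of \<open>v\<close> enters depends on
    \<open>reflects u\<close>, so both combinations are needed.\<close>
  then have "int n dvd (exponent u - exponent u') + (exponent v - exponent v')"
    "int n dvd (exponent u - exponent u') - (exponent v - exponent v')"
    by (auto intro: dvd_add dvd_diff)
  with append show ?case
    by (auto simp: reflects_append exponent_append algebra_simps)
qed simp

definition rotation_word :: "int \<Rightarrow> dihedral_gen gword" where
  "rotation_word k = (if k \<ge> 0 then replicate (nat k) (Gen gen_a) else replicate (nat (- k)) (Inv gen_a))"

definition normal_word :: "int \<Rightarrow> bool \<Rightarrow> dihedral_gen gword" where
  "normal_word k s = rotation_word k @ (if s then [Gen gen_b] else [])"

definition dihedral_elem :: "nat \<Rightarrow> int \<Rightarrow> bool \<Rightarrow> dihedral_gen gword set" where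
  "dihedral_elem n k s = pres_class (dihedral_relations n) (normal_word k s)"

lemma reflects_normal_word: "reflects (normal_word k s) = s"
  by (auto simp: normal_word_def rotation_word_def reflects_append reflects_replicate)

lemma exponent_normal_word: "exponent (normal_word k s) = k"
  by (auto simp: normal_word_def rotation_word_def exponent_append exponent_replicate)

text \<open>Iterating the relation moves natural powers of \<open>a\<close> past \<open>b\<close>
  from the left; the mirrored rule \<open>nat'\<close> settles nonnegative \<open>k\<close>, and
  \<open>nat\<close> itself settles nonpositive \<open>k\<close>.\<close>

lemma (in group) conj_inverting_int_pow:
  assumes a: "a \<in> carrier G" and b: "b \<in> carrier G" and ab: "a \<otimes> b = b \<otimes> inv a"
  shows "b \<otimes> a [^] (k :: int) = a [^] (- k) \<otimes> b"
proof -
  have nat: "a [^] (m :: nat) \<otimes> b = b \<otimes> inv (a [^] m)" for m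
  proof (induction m)
    case (Suc m)
    have "a [^] Suc m \<otimes> b = a [^] m \<otimes> (b \<otimes> inv a)"
      using a b by (simp add: m_assoc ab)
    also have "\<dots> = b \<otimes> (inv (a [^] m) \<otimes> inv a)"
      using a b Suc by (simp flip: m_assoc)
    also have "inv (a [^] m) \<otimes> inv a = inv (a [^] Suc m)"
      using a by (subst nat_pow_Suc2) (simp_all add: inv_mult_group)
    finally show ?case .
  qed (use b in simp)
  have nat': "b \<otimes> a [^] (m :: nat) = inv (a [^] m) \<otimes> b" for m
  proof -
    \<comment> \<open>Padding with a cancelling pair exposes a factor that \<open>nat\<close>, read
      backwards, can swap.\<close>
    have "inv (a [^] m) \<otimes> b = inv (a [^] m) \<otimes> (b \<otimes> inv (a [^] m)) \<otimes> a [^] m"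
      using a b by (simp add: m_assoc)
    also have "\<dots> = inv (a [^] m) \<otimes> (a [^] m \<otimes> b) \<otimes> a [^] m"
      by (simp add: nat)
    also have "\<dots> = b \<otimes> a [^] m"
      using a b by (simp flip: m_assoc)
    finally show ?thesis by simp
  qed
  show ?thesis
  proof (cases k rule: int_cases2)
    case (nonneg m)
    then show ?thesis using a nat' by (simp add: int_pow_neg int_pow_int)
  next
    case (nonpos m)
    then show ?thesis using a nat[of m] by (simp add: int_pow_neg int_pow_int)
  qed
qed

section \<open>Multiplication and equality of normal forms\<close>

context
  fixes n :: nat
begin

interpretation P: group "presented_group (dihedral_relations n)"
  by (rule group_presented_group)

abbreviation (input) "P \<equiv> presented_group (dihedral_relations n)"
abbreviation (input) "cl \<equiv> pres_class (dihedral_relations n)"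

lemma cl_carrier: "cl w \<in> carrier P"
  by (simp add: carrier_presented_group)

lemma cl_Inv: "cl [Inv x] = inv\<^bsub>P\<^esub> cl [Gen x]"
  by (rule P.inv_equality[symmetric])
    (auto simp: mult_pres_class one_presented_group pres_class_eq_iff cl_carrier intro: pres_eq.inv_gen)

lemma cl_replicate: "cl (replicate m l) = cl [l] [^]\<^bsub>P\<^esub> m"
proof (induction m)
  case 0
  show ?case by (simp add: one_presented_group)
next
  case (Suc m)
  then show ?case
    using cl_carrier by (simp add: mult_pres_class P.nat_pow_Suc2 flip: Suc del: P.nat_pow_Suc nat_pow_Suc)
qed

lemma cl_rotation_word: "cl (rotation_word k) = cl [Gen gen_a] [^]\<^bsub>P\<^esub> k"
proof (cases k rule: int_cases2)
  case (nonneg m)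
  then show ?thesis by (simp add: rotation_word_def cl_replicate int_pow_int)
next
  case (nonpos m)
  then show ?thesis
    using cl_carrier
    by (auto simp: rotation_word_def cl_replicate cl_Inv int_pow_int P.int_pow_neg P.nat_pow_inv
        simp flip: one_presented_group)
qed

lemma dihedral_elem_eq:
  "dihedral_elem n k s =
     cl [Gen gen_a] [^]\<^bsub>P\<^esub> k \<otimes>\<^bsub>P\<^esub> (if s then cl [Gen gen_b] else \<one>\<^bsub>P\<^esub>)"
  by (simp add: dihedral_elem_def normal_word_def cl_rotation_word[symmetric] mult_pres_class
      one_presented_group)

lemma cl_relations:
  "cl [Gen gen_a] [^]\<^bsub>P\<^esub> n = \<one>\<^bsub>P\<^esub>"
  "cl [Gen gen_b] \<otimes>\<^bsub>P\<^esub> cl [Gen gen_b] = \<one>\<^bsub>P\<^esub>"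
  "cl [Gen gen_a] \<otimes>\<^bsub>P\<^esub> cl [Gen gen_b] = cl [Gen gen_b] \<otimes>\<^bsub>P\<^esub> inv\<^bsub>P\<^esub> cl [Gen gen_a]"
proof -
  show "cl [Gen gen_a] [^]\<^bsub>P\<^esub> n = \<one>\<^bsub>P\<^esub>"
    unfolding cl_replicate[symmetric] one_presented_group
    by (rule pres_class_relation) (simp add: dihedral_relations_def)
  show "cl [Gen gen_b] \<otimes>\<^bsub>P\<^esub> cl [Gen gen_b] = \<one>\<^bsub>P\<^esub>"
    unfolding mult_pres_class one_presented_group
    by (rule pres_class_relation) (simp add: dihedral_relations_def numeral_2_eq_2)
  show "cl [Gen gen_a] \<otimes>\<^bsub>P\<^esub> cl [Gen gen_b] = cl [Gen gen_b] \<otimes>\<^bsub>P\<^esub> inv\<^bsub>P\<^esub> cl [Gen gen_a]"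
    unfolding mult_pres_class cl_Inv[symmetric]
    by (rule pres_class_relation) (simp add: dihedral_relations_def)
qed

lemma dihedral_elem_mult:
  "dihedral_elem n k s \<otimes>\<^bsub>P\<^esub> dihedral_elem n l t = dihedral_elem n (if s then k - l else k + l) (s \<noteq> t)"
proof -
  let ?a = "cl [Gen gen_a]" and ?b = "cl [Gen gen_b]"
  have c: "?a \<in> carrier P" "?b \<in> carrier P" by (rule cl_carrier)+
  have swap: "?b \<otimes>\<^bsub>P\<^esub> ?a [^]\<^bsub>P\<^esub> l = ?a [^]\<^bsub>P\<^esub> (- l) \<otimes>\<^bsub>P\<^esub> ?b"
    by (rule P.conj_inverting_int_pow[OF c cl_relations(3)])
  show ?thesis
  proof (cases s)
    case False
    then show ?thesis
      using c by (simp add: dihedral_elem_eq P.int_pow_mult P.m_assoc)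
  next
    case True
    let ?t = "if t then ?b else \<one>\<^bsub>P\<^esub>"
    have t: "?t \<in> carrier P" using c by simp
    have "dihedral_elem n k s \<otimes>\<^bsub>P\<^esub> dihedral_elem n l t =
        ?a [^]\<^bsub>P\<^esub> k \<otimes>\<^bsub>P\<^esub> ((?b \<otimes>\<^bsub>P\<^esub> ?a [^]\<^bsub>P\<^esub> l) \<otimes>\<^bsub>P\<^esub> ?t)"
      using c t True by (simp add: dihedral_elem_eq P.m_assoc)
    also have "\<dots> = ?a [^]\<^bsub>P\<^esub> (k - l) \<otimes>\<^bsub>P\<^esub> (?b \<otimes>\<^bsub>P\<^esub> ?t)"
      unfolding swap using c t P.int_pow_mult[of ?a k "- l"] by (simp add: P.m_assoc)
    also have "\<dots> = dihedral_elem n (k - l) (\<not> t)"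
      using c cl_relations(2) by (simp add: dihedral_elem_eq)
    finally show ?thesis using True by simp
  qed
qed

text \<open>Normal forms exhaust the group: it is enough to check single letters, because
  \<open>dihedral_elem_mult\<close> follows the same rule as \<open>exponent_append\<close> and
  \<open>reflects_append\<close>.\<close>

lemma cl_eq_dihedral_elem: "cl w = dihedral_elem n (exponent w) (reflects w)"
proof (induction w)
  case Nil
  show ?case by (simp add: dihedral_elem_def normal_word_def rotation_word_def)
next
  case (Cons l w)
  have b: "inv\<^bsub>P\<^esub> cl [Gen gen_b] = cl [Gen gen_b]"
    by (rule P.inv_equality) (auto simp: cl_relations cl_carrier)
  have l: "cl [l] = dihedral_elem n (exponent [l]) (reflects [l])"
  proof (cases l)
    case (Gen x)
    then show ?thesis
      using cl_carrier by (cases x) (auto simp: dihedral_elem_eq P.int_pow_1)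
  next
    case (Inv x)
    then show ?thesis
      using cl_carrier b by (cases x) (auto simp: dihedral_elem_eq cl_Inv P.int_pow_1 P.int_pow_neg)
  qed
  have "cl ([l] @ w) = cl [l] \<otimes>\<^bsub>P\<^esub> cl w"
    by (rule mult_pres_class[symmetric])
  also have "\<dots> = dihedral_elem n (exponent ([l] @ w)) (reflects ([l] @ w))"
    unfolding l Cons exponent_append reflects_append dihedral_elem_mult by simp
  finally show ?case by simp
qed

text \<open>The word invariants separate normal forms; conversely, exponents congruent modulo
  \<open>n\<close> agree because the \<open>n\<close>-th power of \<open>a\<close> is
  trivial.\<close>

lemma dihedral_elem_eq_iff:
  "dihedral_elem n k s = dihedral_elem n l t \<longleftrightarrow> s = t \<and> int n dvd k - l"
proof
  assume "dihedral_elem n k s = dihedral_elem n l t"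
  then show "s = t \<and> int n dvd k - l"
    using pres_eq_dihedral_invariant[of n "normal_word k s" "normal_word l t"]
    by (simp add: dihedral_elem_def pres_class_eq_iff reflects_normal_word exponent_normal_word)
next
  assume "s = t \<and> int n dvd k - l"
  then obtain q where q: "k = l + int n * q" and st: "s = t"
    by (auto simp: dvd_def algebra_simps)
  have "cl [Gen gen_a] [^]\<^bsub>P\<^esub> (int n * q) = (cl [Gen gen_a] [^]\<^bsub>P\<^esub> int n) [^]\<^bsub>P\<^esub> q"
    by (rule P.int_pow_pow[symmetric, OF cl_carrier])
  then have "cl [Gen gen_a] [^]\<^bsub>P\<^esub> (int n * q) = \<one>\<^bsub>P\<^esub>"
    by (simp add: int_pow_int cl_relations)
  then show "dihedral_elem n k s = dihedral_elem n l t"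
    using cl_carrier by (simp add: dihedral_elem_eq q st P.int_pow_mult)
qed

end

text \<open>Carries the graph argument of the locale over to the group given by the
  presentation.\<close>

lemma dihedral_dihedral_group:
  assumes "n \<ge> 3"
  shows "dihedral (dihedral_group n) (int n) (dihedral_elem n)"
proof -
  interpret group "dihedral_group n"
    unfolding dihedral_group_def by (rule group_presented_group)
  show ?thesis
  proof
    show "carrier (dihedral_group n) = {dihedral_elem n k s |k s. True}"
      using cl_eq_dihedral_elem[of n]
      by (auto simp: dihedral_group_def carrier_presented_group dihedral_elem_def)
  qed (use assms in \<open>auto simp: dihedral_group_def dihedral_elem_mult dihedral_elem_eq_iff\<close>)
qed

theorem theorem4p9:
  fixes n :: nat
  assumes "n \<ge> 3"
  shows "split_graph (permutability_graph (dihedral_group n)) \<longleftrightarrow> prime n \<and> odd n"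
  using dihedral.split_graph_iff[OF dihedral_dihedral_group[OF assms]] by simp

end
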